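(* Let $f_1,\dots,f_n$ be monotone linear functions. A permutation $\sigma$ of $[n]$ is minimum if and only if it is locally optimal.
   Context: A linear function is $f(x)=ax+b$; monotone means $a>0$. For a permutation $\sigma$ of $[n]$, $f^\sigma=f_{\sigma(n)}\circ\cdots\circ f_{\sigma(1)}$; $\sigma$ is minimum if $f^\sigma(x)\le f^\rho(x)$ for all $x$ and all permutations $\rho$. For $1\le\ell\le m<r\le n$, $\sigma_{\ell,m,r}$ is obtained from $\sigma$ by swapping the adjacent blocks $(\sigma(\ell),\dots,\sigma(m))$ and $(\sigma(m+1),\dots,\sigma(r))$: $\sigma_{\ell,m,r}(i)=\sigma(i)$ for $i<\ell$ or $i>r$, $=\sigma(i-\ell+m+1)$ for $\ell\le i<\ell-m+r$, $=\sigma(i+m-r)$ for $\ell-m+r\le i\le r$. $N(\sigma)=\{\sigma_{\ell,m,r}\}$, and $\sigma$ is locally optimal if $f^\sigma\le f^\mu$ pointwise for all $\mu\in N(\sigma)$. *)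

theory Defs
  imports "HOL-Combinatorics.Permutations" Complex_Main
begin

definition lin :: "(nat \<Rightarrow> real) \<Rightarrow> (nat \<Rightarrow> real) \<Rightarrow> nat \<Rightarrow> real \<Rightarrow> real" where
  "lin a b i x = a i * x + b i"

fun comp_perm :: "(nat \<Rightarrow> real) \<Rightarrow> (nat \<Rightarrow> real) \<Rightarrow> (nat \<Rightarrow> nat) \<Rightarrow> nat \<Rightarrow> real \<Rightarrow> real" where
  "comp_perm a b \<sigma> 0 x = x"
| "comp_perm a b \<sigma> (Suc k) x = lin a b (\<sigma> (Suc k)) (comp_perm a b \<sigma> k x)"

definition fsig :: "(nat \<Rightarrow> real) \<Rightarrow> (nat \<Rightarrow> real) \<Rightarrow> nat \<Rightarrow> (nat \<Rightarrow> nat) \<Rightarrow> real \<Rightarrow> real" where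
  "fsig a b n \<sigma> = comp_perm a b \<sigma> n"

definition is_minimum :: "(nat \<Rightarrow> real) \<Rightarrow> (nat \<Rightarrow> real) \<Rightarrow> nat \<Rightarrow> (nat \<Rightarrow> nat) \<Rightarrow> bool" where
  "is_minimum a b n \<sigma> \<longleftrightarrow>
     (\<forall>\<rho>. \<rho> permutes {1..n} \<longrightarrow> (\<forall>x. fsig a b n \<sigma> x \<le> fsig a b n \<rho> x))"

definition block_swap :: "(nat \<Rightarrow> nat) \<Rightarrow> nat \<Rightarrow> nat \<Rightarrow> nat \<Rightarrow> nat \<Rightarrow> nat" where
  "block_swap \<sigma> l m r i =
     (if i < l \<or> i > r then \<sigma> i
      else if i + m < l + r then \<sigma> (i - l + m + 1)
      else \<sigma> (i + m - r))"

definition nbhd :: "nat \<Rightarrow> (nat \<Rightarrow> nat) \<Rightarrow> (nat \<Rightarrow> nat) set" where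
  "nbhd n \<sigma> = {block_swap \<sigma> l m r | l m r. 1 \<le> l \<and> l \<le> m \<and> m < r \<and> r \<le> n}"

definition locally_optimal :: "(nat \<Rightarrow> real) \<Rightarrow> (nat \<Rightarrow> real) \<Rightarrow> nat \<Rightarrow> (nat \<Rightarrow> nat) \<Rightarrow> bool" where
  "locally_optimal a b n \<sigma> \<longleftrightarrow>
     (\<forall>\<mu>\<in>nbhd n \<sigma>. \<forall>x. fsig a b n \<sigma> x \<le> fsig a b n \<mu> x)"

end

theory Submission
  imports Defs "HOL-Library.Multiset"
begin

text \<open>
  To $f(x) = ax + b$ attach the vector $(1-a, b)$. The vector of a composition is a combination of
  the vectors of its factors with positive coefficients, and whether $g \circ f \le f \circ g$
  is decided by the sign of the determinant of the two vectors. Local optimality says that this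
  determinant is nonnegative for every pair of adjacent blocks.

  Let $\sigma$ be locally optimal and $\rho$ a minimum. If some functions $g, h$ are consecutive in
  this order in both sequences, replace them by $h \circ g$: block swaps of the shorter sequence
  are block swaps of $\sigma$, and one concludes by induction on the number of functions. It
  remains to find neighbours $g, h$ of $\sigma$ that can be made consecutive in some minimum. If
  the determinant of $g, h$ vanishes, the functions between $g$ and $h$ in $\rho$ commute with $g$
  or with $h$. Otherwise choose $g, h$ such that $g$ comes before $h$ in $\rho$. Convexity of the
  polygon formed by $\sigma$ shows that no vector lies strictly inside the cone of $g$ and $h$,
  and therefore $g$ commutes with its successor in $\rho$ or $h$ commutes with everything between.
\<close>

section \<open>Compositions of affine maps, their plane vectors and determinants\<close>

type_synonym affine = "real \<times> real"

text \<open>A list of pairs $(a, b)$ is composed with its head applied first.\<close>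

definition slope :: "affine list \<Rightarrow> real" where
  "slope xs = prod_list (map fst xs)"

fun intercept :: "affine list \<Rightarrow> real" where
  "intercept [] = 0"
| "intercept (x # xs) = slope xs * snd x + intercept xs"

definition composite :: "affine list \<Rightarrow> affine" where
  "composite xs = (slope xs, intercept xs)"

text \<open>The determinant of the vectors \<open>(1 - slope, intercept)\<close> of
  \<open>ys\<close> and \<open>xs\<close>, in this order. It equals
  \<open>intercept (ys @ xs) - intercept (xs @ ys)\<close>, so it is nonnegative exactly when
  applying \<open>xs\<close> first is at least as good.\<close>

definition vdet :: "affine list \<Rightarrow> affine list \<Rightarrow> real" where
  "vdet xs ys = intercept xs * (1 - slope ys) - intercept ys * (1 - slope xs)"

definition increasing :: "affine list \<Rightarrow> bool" where
  "increasing xs \<longleftrightarrow> (\<forall>x\<in>set xs. fst x > 0)"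

text \<open>Empty blocks are allowed: their vector is zero and imposes nothing.\<close>

definition loc_opt :: "affine list \<Rightarrow> bool" where
  "loc_opt xs \<longleftrightarrow> (\<forall>us X Y vs. xs = us @ X @ Y @ vs \<longrightarrow> vdet X Y \<ge> 0)"

text \<open>The slope does not depend on the order, so comparing intercepts compares the composites
  at every point.\<close>

definition minimum :: "affine list \<Rightarrow> bool" where
  "minimum xs \<longleftrightarrow> (\<forall>ys. mset ys = mset xs \<longrightarrow> intercept xs \<le> intercept ys)"

lemma slope_simps [simp]:
  "slope [] = 1" "slope (x # xs) = fst x * slope xs" "slope (xs @ ys) = slope xs * slope ys"
  by (simp_all add: slope_def)

lemma intercept_append [simp]:
  "intercept (xs @ ys) = slope ys * intercept xs + intercept ys"
  by (induction xs) (simp_all add: algebra_simps)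

lemma increasing_simps [simp]:
  "increasing []" "increasing (x # xs) \<longleftrightarrow> fst x > 0 \<and> increasing xs"
  "increasing (xs @ ys) \<longleftrightarrow> increasing xs \<and> increasing ys"
  by (auto simp: increasing_def)

lemma slope_pos: "increasing xs \<Longrightarrow> slope xs > 0"
  by (induction xs) auto

lemma increasing_mset_cong: "mset xs = mset ys \<Longrightarrow> increasing xs \<longleftrightarrow> increasing ys"
  unfolding increasing_def by (metis set_mset_mset)

lemma slope_map_composite: "slope (map composite xss) = slope (concat xss)"
  by (induction xss) (simp_all add: composite_def)

lemma intercept_map_composite: "intercept (map composite xss) = intercept (concat xss)"
proof (induction xss)
  case (Cons X xss)
  have "snd (composite X) = intercept X" by (simp add: composite_def)
  with Cons show ?case by (simp add: slope_map_composite)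
qed simp

lemma vdet_Nil [simp]: "vdet [] ys = 0" "vdet xs [] = 0"
  by (simp_all add: vdet_def)

lemma vdet_self [simp]: "vdet xs xs = 0"
  by (simp add: vdet_def)

lemma vdet_antisym: "vdet ys xs = - vdet xs ys"
  by (simp add: vdet_def)

text \<open>The vector of \<open>xs @ ys\<close> is that of \<open>ys\<close> plus
  \<open>slope ys\<close> times that of \<open>xs\<close>.\<close>

lemma vdet_append_left: "vdet (xs @ ys) zs = vdet ys zs + slope ys * vdet xs zs"
  by (simp add: vdet_def algebra_simps)

lemma vdet_append_right: "vdet zs (xs @ ys) = vdet zs ys + slope ys * vdet zs xs"
  by (simp add: vdet_def algebra_simps)

text \<open>Cramer's rule in the plane: det(g,h) x = det(x,h) g + det(g,x) h, paired with
  \<open>z\<close>. It carries sign information from \<open>g\<close> and \<open>h\<close> over to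
  \<open>x\<close>.\<close>

lemma vdet_pluecker:
  "vdet z x * vdet g h = vdet x h * vdet z g + vdet g x * vdet z h"
  by (simp add: vdet_def algebra_simps)

text \<open>The contribution of \<open>us\<close> cancels, because \<open>X @ Y\<close> and
  \<open>Y @ X\<close> have the same slope.\<close>

lemma intercept_swap:
  "intercept (us @ Y @ X @ vs) = intercept (us @ X @ Y @ vs) + slope vs * vdet X Y"
  by (simp add: vdet_def algebra_simps)

section \<open>Local optimality and minimality of lists\<close>

lemma loc_optD: "loc_opt xs \<Longrightarrow> xs = us @ X @ Y @ vs \<Longrightarrow> vdet X Y \<ge> 0"
  by (auto simp: loc_opt_def)

text \<open>A cut of the list of composites lifts to a cut of the concatenation with the same slopes
  and intercepts. This allows neighbours to be merged in the induction.\<close>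

lemma loc_opt_map_composite:
  assumes "loc_opt (concat xss)"
  shows "loc_opt (map composite xss)"
  unfolding loc_opt_def
proof (intro allI impI)
  fix us X Y vs assume "map composite xss = us @ X @ Y @ vs"
  then obtain us' X' Y' vs' where
    eq: "xss = us' @ X' @ Y' @ vs'" "X = map composite X'" "Y = map composite Y'"
    by (force simp: map_eq_append_conv append_eq_map_conv)
  have "vdet (concat X') (concat Y') \<ge> 0"
    using assms by (rule loc_optD) (simp add: eq)
  then show "vdet X Y \<ge> 0"
    by (simp add: eq vdet_def slope_map_composite intercept_map_composite)
qed

lemma minimum_imp_loc_opt:
  assumes "minimum xs" "increasing xs"
  shows "loc_opt xs"
  unfolding loc_opt_def
proof (intro allI impI)
  fix us X Y vs assume eq: "xs = us @ X @ Y @ vs"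
  have "intercept xs \<le> intercept (us @ Y @ X @ vs)"
    using assms(1) eq unfolding minimum_def
    by (auto simp only: mset_append ac_simps dest!: spec[of _ "us @ Y @ X @ vs"])
  then have "slope vs * vdet X Y \<ge> 0"
    by (simp only: intercept_swap[of us Y X vs] eq)
  moreover have "slope vs > 0"
    using assms(2) eq by (simp add: slope_pos)
  ultimately show "vdet X Y \<ge> 0"
    by (simp add: zero_le_mult_iff)
qed

lemma minimum_swap:
  assumes "minimum (us @ X @ Y @ vs)" "vdet X Y = 0"
  shows "minimum (us @ Y @ X @ vs)"
  using assms unfolding minimum_def intercept_swap[of us Y X vs]
  by (simp add: ac_simps)

lemma ex_minimum: "\<exists>ys. mset ys = mset xs \<and> minimum ys"
proof -
  let ?S = "{ys. mset ys = mset xs}"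
  have "?S \<subseteq> {ys. set ys \<subseteq> set xs \<and> length ys = length xs}"
    by (auto dest: mset_eq_setD mset_eq_length)
  then have "finite ?S"
    by (rule finite_subset) (simp add: finite_lists_length_eq)
  moreover have "?S \<noteq> {}" by auto
  ultimately obtain ys where "ys \<in> ?S" "\<And>zs. zs \<in> ?S \<Longrightarrow> intercept ys \<le> intercept zs"
    by (metis arg_min_if_finite(1) arg_min_least)
  then show ?thesis by (auto simp: minimum_def)
qed

section \<open>Vectors relative to the cone of two neighbours\<close>

text \<open>The block \<open>Z @ [g]\<close> or \<open>[h] @ Z\<close> next to \<open>x\<close> has
  determinants of one sign against \<open>g\<close> and \<open>h\<close>, one of them strictly. By
  the Pluecker relation it has that strict sign against \<open>x\<close> too, so swapping it with
  \<open>x\<close> would be an improvement.\<close>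

lemma loc_opt_not_in_cone:
  assumes opt: "loc_opt (us @ g # h # vs)" and inc: "increasing (us @ g # h # vs)"
    and x: "x \<in> set (us @ g # h # vs)"
    and gh: "vdet [g] [h] > 0" and gx: "vdet [g] [x] > 0" and xh: "vdet [x] [h] > 0"
  shows False
proof -
  have "x \<noteq> g" "x \<noteq> h" using gx xh by auto
  with x consider "x \<in> set us" | "x \<in> set vs" by auto
  then show False
  proof cases
    case 1
    then obtain W Z where us: "us = W @ x # Z" by (meson split_list)
    have a: "slope Z > 0" "fst g > 0" using inc us by (auto intro: slope_pos)
    have 1: "vdet [x] (Z @ [g]) \<ge> 0"
      by (rule loc_optD[OF opt, of W _ _ "h # vs"]) (simp add: us)
    have 2: "vdet ([x] @ Z) [g] \<ge> 0"
      by (rule loc_optD[OF opt, of W _ _ "h # vs"]) (simp add: us)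
    have 3: "vdet (Z @ [g]) [h] \<ge> 0"
      by (rule loc_optD[OF opt, of "W @ [x]" _ _ vs]) (simp add: us)
    \<comment> \<open>Alone, \<open>[x]\<close> has a negative determinant with \<open>[g]\<close>,
      so \<open>Z\<close> must compensate.\<close>
    have "vdet Z [g] > 0"
      using 2 mult_pos_pos[OF a(1) gx]
      by (simp only: vdet_append_left vdet_antisym[of "[x]" "[g]"])
    then have "vdet (Z @ [g]) [g] > 0"
      using a(2) by (simp add: vdet_append_left)
    then have "vdet [x] [h] * vdet (Z @ [g]) [g] + vdet [g] [x] * vdet (Z @ [g]) [h] > 0"
      using 3 gx xh by (simp add: add_pos_nonneg)
    then have "vdet (Z @ [g]) [x] * vdet [g] [h] > 0"
      by (simp only: vdet_pluecker[of "Z @ [g]" "[x]" "[g]" "[h]"])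
    then show False
      using 1 gh by (simp add: mult_less_0_iff vdet_antisym[of "Z @ [g]"])
  next
    case 2
    then obtain Z W where vs: "vs = Z @ x # W" by (meson split_list)
    have a: "fst x > 0" "slope Z > 0" using inc vs by (auto intro: slope_pos)
    have 1: "vdet ([h] @ Z) [x] \<ge> 0"
      by (rule loc_optD[OF opt, of "us @ [g]" _ _ W]) (simp add: vs)
    have 2: "vdet [h] (Z @ [x]) \<ge> 0"
      by (rule loc_optD[OF opt, of "us @ [g]" _ _ W]) (simp add: vs)
    have 3: "vdet [g] ([h] @ Z) \<ge> 0"
      by (rule loc_optD[OF opt, of us _ _ "x # W"]) (simp add: vs)
    have "fst x * vdet [h] Z > 0"
      using 2 xh by (simp add: vdet_append_right vdet_antisym[of "[h]" "[x]"])
    then have "vdet [h] Z > 0"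
      using a by (simp add: zero_less_mult_iff)
    then have 4: "vdet ([h] @ Z) [h] < 0"
      by (simp only: vdet_append_left vdet_self vdet_antisym[of Z])
    have "vdet ([h] @ Z) [g] \<le> 0"
      using 3 by (simp only: vdet_antisym[of "[h] @ Z"])
    then have "vdet [x] [h] * vdet ([h] @ Z) [g] + vdet [g] [x] * vdet ([h] @ Z) [h] < 0"
      using 4 gx xh by (intro add_nonpos_neg mult_nonneg_nonpos mult_pos_neg) auto
    then have "vdet ([h] @ Z) [x] * vdet [g] [h] < 0"
      by (simp only: vdet_pluecker[of "[h] @ Z" "[x]" "[g]" "[h]"])
    then show False
      using 1 gh by (simp add: mult_less_0_iff)
  qed
qed

lemma vdet_zero_elements_right:
  assumes "\<And>A B. Z = A @ B \<Longrightarrow> vdet g A = 0" "z \<in> set Z"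
  shows "vdet g [z] = 0"
proof -
  obtain A B where "Z = A @ z # B" using assms(2) by (meson split_list)
  then have "vdet g A = 0" "vdet g (A @ [z]) = 0" by (auto intro: assms(1))
  then show ?thesis by (simp add: vdet_append_right)
qed

text \<open>The vector of \<open>z # B\<close> exceeds that of \<open>B\<close> by
  \<open>slope B\<close> times the vector of \<open>z\<close>; positivity of this slope allows it to
  be cancelled.\<close>

lemma vdet_zero_elements_left:
  assumes "\<And>A B. Z = A @ B \<Longrightarrow> vdet B g = 0" "z \<in> set Z" "increasing Z"
  shows "vdet [z] g = 0"
proof -
  obtain A B where Z: "Z = A @ z # B" using assms(2) by (meson split_list)
  then have "vdet B g = 0" "vdet ([z] @ B) g = 0"
    by (auto intro: assms(1)[of "A @ [z]"] assms(1)[of A])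
  moreover have "slope B > 0" using Z assms(3) by (simp add: slope_pos)
  ultimately show ?thesis unfolding vdet_append_left by simp
qed

lemma vdet_zero_block:
  assumes "\<And>z. z \<in> set X \<Longrightarrow> vdet g [z] = 0"
  shows "vdet g X = 0"
  using assms
proof (induction X)
  case (Cons z X)
  then show ?case using vdet_append_right[of g "[z]" X] by simp
qed simp

text \<open>Here \<open>h\<close> points opposite to \<open>g\<close>. Optimality therefore bounds
  the determinant with \<open>g\<close> of every block adjacent to the pair from both sides, and all
  such blocks, hence all elements, are parallel to \<open>g\<close>.\<close>

lemma loc_opt_backtracking:
  assumes opt: "loc_opt (us @ g # h # vs)" and inc: "increasing (us @ g # h # vs)"
    and k: "k < 0" "\<And>zs. vdet zs [h] = k * vdet zs [g]"
    and x: "x \<in> set (us @ g # h # vs)"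
  shows "vdet [g] [x] = 0"
proof -
  have gh: "vdet [g] [h] = 0" by (simp add: k)
  consider "x \<in> set us" | "x = g \<or> x = h" | "x \<in> set vs" using x by auto
  then show ?thesis
  proof cases
    case 1
    have "vdet B [g] = 0" if "us = A @ B" for A B
    proof -
      have "vdet B [g] \<ge> 0"
        by (rule loc_optD[OF opt, of A _ _ "h # vs"]) (simp add: that)
      moreover have "vdet (B @ [g]) [h] \<ge> 0"
        by (rule loc_optD[OF opt, of A _ _ vs]) (simp add: that)
      then have "fst g * (k * vdet B [g]) \<ge> 0"
        by (simp add: vdet_append_left gh k mult.left_commute)
      then have "vdet B [g] \<le> 0"
        using inc k(1) by (simp add: zero_le_mult_iff)
      ultimately show ?thesis by simp
    qed
    then have "vdet [x] [g] = 0"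
      using vdet_zero_elements_left[of us "[g]" x] 1 inc by auto
    then show ?thesis by (simp add: vdet_antisym[of "[g]"])
  next
    case 2
    then show ?thesis using gh by auto
  next
    case 3
    have "vdet [g] A = 0" if "vs = A @ B" for A B
    proof -
      have "vdet [h] A \<ge> 0"
        by (rule loc_optD[OF opt, of "us @ [g]" _ _ B]) (simp add: that)
      then have "k * vdet A [g] \<le> 0"
        by (simp add: vdet_antisym[of "[h]"] k)
      then have "vdet [g] A \<le> 0"
        using k(1) by (simp add: mult_le_0_iff vdet_antisym[of "[g]" A])
      moreover have "vdet [g] ([h] @ A) \<ge> 0"
        by (rule loc_optD[OF opt, of us _ _ B]) (simp add: that)
      then have "vdet [g] A \<ge> 0"
        by (simp only: vdet_append_right gh)
      ultimately show ?thesis by simp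
    qed
    then show ?thesis
      using vdet_zero_elements_right[of vs "[g]" x] 3 by auto
  qed
qed

section \<open>Neighbours made consecutive in a minimum\<close>

lemma parallel_cases:
  assumes "vdet [g] [h] = 0"
  obtains (zero_left) "\<And>zs. vdet zs [g] = 0" | (zero_right) "\<And>zs. vdet zs [h] = 0"
    | (multiple) k where "k \<noteq> 0" "\<And>zs. vdet zs [h] = k * vdet zs [g]"
proof -
  obtain p q where g: "g = (p, q)" by (cases g)
  obtain r s where h: "h = (r, s)" by (cases h)
  have eq: "q * (1 - r) = s * (1 - p)" using assms by (simp add: vdet_def g h)
  consider "p = 1" "q = 0" | "r = 1" "s = 0"
    | "p \<noteq> 1 \<or> q \<noteq> 0" "r \<noteq> 1 \<or> s \<noteq> 0" by auto
  then show thesis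
  proof cases
    case 1
    then show ?thesis by (intro zero_left) (simp add: vdet_def g)
  next
    case 2
    then show ?thesis by (intro zero_right) (simp add: vdet_def h)
  next
    case 3
    show ?thesis
    \<comment> \<open>Slope 1 means a translation, where the factor is read off the intercepts;
      otherwise it is the ratio of the first coordinates.\<close>
    proof (cases "p = 1")
      case True
      then have "q \<noteq> 0" "r = 1" "s \<noteq> 0" using 3 eq by auto
      then show ?thesis using True
        by (intro multiple[of "s / q"]) (simp_all add: vdet_def g h)
    next
      case False
      then have r: "r \<noteq> 1" using 3 eq by auto
      have s: "s = (1 - r) / (1 - p) * q" using eq False by (simp add: field_simps)
      have r': "1 - r = (1 - r) / (1 - p) * (1 - p)" using False by simp
      have "vdet zs [h] = (1 - r) / (1 - p) * vdet zs [g]" for zs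
      proof -
        have "vdet zs [h] = intercept zs * (1 - r) - s * (1 - slope zs)"
          by (simp add: vdet_def h)
        also have "\<dots> = intercept zs * ((1 - r) / (1 - p) * (1 - p))
            - (1 - r) / (1 - p) * q * (1 - slope zs)"
          by (simp only: s r'[symmetric])
        also have "\<dots> = (1 - r) / (1 - p) * vdet zs [g]"
          unfolding vdet_def g by (simp only: intercept.simps slope_simps)
            (simp only: algebra_simps fst_conv snd_conv mult_1_right mult_1_left add_0_right)
        finally show ?thesis .
      qed
      then show ?thesis
        using r False by (intro multiple[of "(1 - r) / (1 - p)"]) auto
    qed
  qed
qed

text \<open>Multiset inclusion rather than membership provides two occurrences even when
  \<open>g = h\<close>.\<close>

lemma two_elements_split:
  assumes "{#g, h#} \<subseteq># mset ys"
  obtains U X V where "ys = U @ g # X @ h # V" | U X V where "ys = U @ h # X @ g # V"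
proof -
  have "g \<in> set ys" using assms by (auto dest: mset_subset_eqD)
  then obtain A B where ys: "ys = A @ g # B" by (meson split_list)
  then have "h \<in># mset (A @ B)" using assms by simp
  then consider "h \<in> set A" | "h \<in> set B" by auto
  then show thesis
  proof cases
    case 1
    then obtain U X where "A = U @ h # X" by (meson split_list)
    then show ?thesis using that(2)[of U X B] ys by simp
  next
    case 2
    then obtain X V where "B = X @ h # V" by (meson split_list)
    then show ?thesis using that(1)[of A X V] ys by simp
  qed
qed

text \<open>The block between \<open>g\<close> and \<open>h\<close> in the minimum commutes with one
  of them, which then moves across it at no cost.\<close>

lemma minimum_adjacent_commuting:
  assumes opt: "loc_opt (us @ g # h # vs)" and inc: "increasing (us @ g # h # vs)"
    and eq: "mset ys = mset (us @ g # h # vs)" and min: "minimum ys"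
    and gh: "vdet [g] [h] = 0"
  shows "\<exists>U V. mset (U @ g # h # V) = mset ys \<and> minimum (U @ g # h # V)"
proof -
  have opt_ys: "loc_opt ys"
    using min inc increasing_mset_cong[OF eq] by (simp add: minimum_imp_loc_opt)
  \<comment> \<open>If \<open>h\<close> is a positive multiple of \<open>g\<close>, the two
    inequalities force the determinant to be 0. If the multiple is negative,
    \<open>loc_opt_backtracking\<close> makes every element parallel to \<open>g\<close>. A zero
    vector is immediate.\<close>
  have between: "vdet X [g] = 0 \<or> vdet X [h] = 0"
    if gXh: "vdet [g] X \<ge> 0 \<and> vdet X [h] \<ge> 0 \<or> vdet [h] X \<ge> 0 \<and> vdet X [g] \<ge> 0"
      and sub: "set X \<subseteq> set ys" for X
  proof (rule parallel_cases[OF gh])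
    fix k assume k: "k \<noteq> 0" "\<And>zs. vdet zs [h] = k * vdet zs [g]"
    show ?thesis
    proof (cases "k > 0")
      case True
      then show ?thesis using gXh
        by (auto simp: vdet_antisym[of _ X] k zero_le_mult_iff mult_le_0_iff)
    next
      case False
      have "vdet [g] [x] = 0" if "x \<in> set X" for x
        using loc_opt_backtracking[OF opt inc, of k x] False k that sub mset_eq_setD[OF eq]
        by auto
      then have "vdet [g] X = 0" by (rule vdet_zero_block)
      then show ?thesis by (simp add: vdet_antisym[of "[g]" X])
    qed
  qed auto
  \<comment> \<open>For the case that \<open>h\<close> precedes \<open>g\<close> in the minimum:
    once adjacent, they may be exchanged because they commute.\<close>
  have final: "\<exists>U V. mset (U @ g # h # V) = mset ys \<and> minimum (U @ g # h # V)"
    if "minimum (U @ h # g # V)" "mset (U @ h # g # V) = mset ys" for U V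
    using minimum_swap[of U "[h]" "[g]" V] that gh
    by (intro exI[of _ U] exI[of _ V]) (simp add: vdet_antisym[of "[g]" "[h]"] add_mset_commute)
  have "{#g, h#} \<subseteq># mset ys" by (simp add: eq)
  then show ?thesis
  proof (cases rule: two_elements_split)
    case (1 U X V)
    have 2: "vdet [g] X \<ge> 0"
      by (rule loc_optD[OF opt_ys, of U _ _ "h # V"]) (simp add: 1)
    have 3: "vdet X [h] \<ge> 0"
      by (rule loc_optD[OF opt_ys, of "U @ [g]" _ _ V]) (simp add: 1)
    have "vdet X [g] = 0 \<or> vdet X [h] = 0"
      using 2 3 1 by (intro between) auto
    then show ?thesis
    proof
      assume "vdet X [g] = 0"
      then have "minimum ((U @ X) @ g # h # V)"
        using minimum_swap[of U "[g]" X "h # V"] min 1 vdet_antisym[of "[g]" X] by simp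
      then show ?thesis using 1 by (intro exI[of _ "U @ X"] exI[of _ V]) simp
    next
      assume "vdet X [h] = 0"
      then have "minimum (U @ g # h # X @ V)"
        using minimum_swap[of "U @ [g]" X "[h]" V] min 1 by simp
      then show ?thesis using 1 by (intro exI[of _ U] exI[of _ "X @ V"]) simp
    qed
  next
    case (2 U X V)
    have 1: "vdet [h] X \<ge> 0"
      by (rule loc_optD[OF opt_ys, of U _ _ "g # V"]) (simp add: 2)
    have 3: "vdet X [g] \<ge> 0"
      by (rule loc_optD[OF opt_ys, of "U @ [h]" _ _ V]) (simp add: 2)
    have "vdet X [g] = 0 \<or> vdet X [h] = 0"
      using 1 2 3 by (intro between) auto
    then show ?thesis
    proof
      assume "vdet X [g] = 0"
      then have "minimum (U @ h # g # X @ V)"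
        using minimum_swap[of "U @ [h]" X "[g]" V] min 2 by simp
      then show ?thesis by (rule final) (simp add: 2)
    next
      assume "vdet X [h] = 0"
      then have "minimum ((U @ X) @ h # g # V)"
        using minimum_swap[of U "[h]" X "g # V"] min 2 vdet_antisym[of "[h]" X] by simp
      then show ?thesis by (rule final) (simp add: 2)
    qed
  qed
qed

text \<open>Elements commuting with \<open>g\<close> are moved in front of it. At the first
  \<open>x\<close> that does not commute, \<open>cone\<close> gives
  \<open>vdet [x] [h] \<le> 0\<close>, and the Pluecker relation forces the whole remaining block
  \<open>x # X\<close> to commute with \<open>h\<close>, which moves to its front.\<close>

lemma minimum_adjacent_positive:
  assumes "minimum (U @ g # X @ h # V)" "increasing (U @ g # X @ h # V)"
    and gh: "vdet [g] [h] > 0"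
    and cone: "\<And>x. x \<in> set X \<Longrightarrow> vdet [g] [x] > 0 \<Longrightarrow> vdet [x] [h] \<le> 0"
  shows "\<exists>U' V'. mset (U' @ g # h # V') = mset (U @ g # X @ h # V)
           \<and> minimum (U' @ g # h # V')"
  using assms
proof (induction X arbitrary: U)
  case Nil
  then show ?case by auto
next
  case (Cons x X)
  have opt: "loc_opt (U @ g # (x # X) @ h # V)"
    using Cons.prems(1,2) by (rule minimum_imp_loc_opt)
  have gx: "vdet [g] [x] \<ge> 0"
    by (rule loc_optD[OF opt, of U _ _ "X @ h # V"]) simp
  show ?case
  proof (cases "vdet [g] [x] = 0")
    case True
    then have "minimum ((U @ [x]) @ g # X @ h # V)"
      using minimum_swap[of U "[g]" "[x]" "X @ h # V"] Cons.prems(1) by simp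
    from Cons.IH[OF this] show ?thesis using Cons.prems by auto
  next
    case False
    with gx have gx: "vdet [g] [x] > 0" by simp
    then have xh: "vdet [x] [h] \<le> 0" by (intro Cons.prems) auto
    have 1: "vdet [g] (x # X) \<ge> 0"
      by (rule loc_optD[OF opt, of U _ _ "h # V"]) simp
    have 2: "vdet (x # X) [h] \<ge> 0"
      by (rule loc_optD[OF opt, of "U @ [g]" _ _ V]) simp
    have "vdet [x] X \<ge> 0"
      by (rule loc_optD[OF opt, of "U @ [g]" _ _ "h # V"]) simp
    then have 3: "vdet (x # X) [x] \<le> 0"
      using vdet_append_left[of "[x]" X "[x]"] by (simp add: vdet_antisym[of X "[x]"])
    have "vdet [x] [h] * vdet (x # X) [g] \<ge> 0"
      using xh 1 by (simp add: vdet_antisym[of "x # X"] mult_nonpos_nonneg)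
    moreover have "vdet [x] [h] * vdet (x # X) [g] + vdet [g] [x] * vdet (x # X) [h] \<le> 0"
      unfolding vdet_pluecker[symmetric] using 3 gh by (simp add: mult_nonpos_nonneg)
    ultimately have "vdet [g] [x] * vdet (x # X) [h] \<le> 0" by linarith
    then have "vdet (x # X) [h] = 0"
      using gx 2 by (simp add: mult_le_0_iff)
    then have "minimum (U @ g # h # (x # X) @ V)"
      using minimum_swap[of "U @ [g]" "x # X" "[h]" V] Cons.prems(1) by simp
    then show ?thesis by (intro exI[of _ U] exI[of _ "(x # X) @ V"]) simp
  qed
qed

text \<open>The first element \<open>y\<close> of \<open>ys\<close> and its successor in
  \<open>xs\<close> will do. If \<open>y\<close> occurs only at the end of \<open>xs\<close>, the
  second element \<open>z\<close> serves instead: its successor is not \<open>y\<close>, since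
  optimality of \<open>ys\<close> gives \<open>vdet [y] [z] \<ge> 0\<close>.\<close>

lemma ex_ordered_adjacent_pair:
  assumes eq: "mset ys = mset xs" and len: "length xs \<ge> 2" and opt: "loc_opt ys"
    and pos: "\<And>us g h vs. xs = us @ g # h # vs \<Longrightarrow> vdet [g] [h] > 0"
  shows "\<exists>us g h vs U X V. xs = us @ g # h # vs \<and> ys = U @ g # X @ h # V"
proof -
  have "length ys \<ge> 2" using len mset_eq_length[OF eq] by simp
  then obtain y z ys' where ys: "ys = y # z # ys'"
    by (cases ys; cases "tl ys") auto
  obtain xs' w where xs: "xs = xs' @ [w]" using len by (cases xs rule: rev_cases) auto
  have sets: "set xs = set ys" using mset_eq_setD[OF eq] by simp
  show ?thesis
  proof (cases "y \<in> set xs'")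
    case True
    then obtain us ts where "xs' = us @ y # ts" by (meson split_list)
    then obtain h vs where xs2: "xs = us @ y # h # vs"
      using xs by (cases "ts @ [w]") auto
    have "h \<noteq> y" using pos[OF xs2] by auto
    then have "h \<in> set (z # ys')" using sets xs2 ys by auto
    then obtain X V where "z # ys' = X @ h # V" by (meson split_list)
    then have "ys = [] @ y # X @ h # V" using ys by simp
    then show ?thesis using xs2 by blast
  next
    case False
    then have w: "y = w" using sets xs ys by auto
    then have "mset (z # ys') = mset xs'" using eq xs ys by simp
    then have "z \<in> set xs'" by (metis list.set_intros(1) mset_eq_setD)
    then obtain us ts where "xs' = us @ z # ts" by (meson split_list)
    then obtain h vs where xs2: "xs = us @ z # h # vs"
      using xs by (cases "ts @ [w]") auto
    note zh = pos[OF xs2]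
    have "vdet [y] [z] \<ge> 0"
      by (rule loc_optD[OF opt, of "[]" _ _ ys']) (simp add: ys)
    then have "h \<noteq> y" using zh vdet_antisym[of "[y]" "[z]"] by auto
    moreover have "h \<noteq> z" using zh by auto
    ultimately have "h \<in> set ys'" using sets xs2 ys by auto
    then obtain X V where "ys' = X @ h # V" by (meson split_list)
    then have "ys = [y] @ z # X @ h # V" using ys by simp
    then show ?thesis using xs2 by blast
  qed
qed

text \<open>Supplies the pair to be merged in the induction. Either some neighbours commute, or all
  adjacent determinants are strictly positive, as the cone argument requires.\<close>

lemma ex_common_adjacent_pair:
  assumes opt: "loc_opt xs" and inc: "increasing xs" and len: "length xs \<ge> 2"
  shows "\<exists>us g h vs U V. xs = us @ g # h # vs \<and>
           mset (U @ g # h # V) = mset xs \<and> minimum (U @ g # h # V)"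
proof -
  obtain ys where ys: "mset ys = mset xs" "minimum ys" using ex_minimum by blast
  have inc_ys: "increasing ys" using inc increasing_mset_cong[OF ys(1)] by simp
  show ?thesis
  proof (cases "\<exists>us g h vs. xs = us @ g # h # vs \<and> vdet [g] [h] = 0")
    case True
    then obtain us g h vs where xs: "xs = us @ g # h # vs" and "vdet [g] [h] = 0" by blast
    with minimum_adjacent_commuting[of us g h vs ys] opt inc ys show ?thesis by metis
  next
    case False
    have pos: "vdet [g] [h] > 0" if "xs = us @ g # h # vs" for us g h vs
    proof -
      have "vdet [g] [h] \<ge> 0"
        by (rule loc_optD[OF opt, of us _ _ vs]) (simp add: that)
      moreover have "vdet [g] [h] \<noteq> 0" using False that by blast
      ultimately show ?thesis by simp
    qed
    obtain us g h vs U X V where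
      xs: "xs = us @ g # h # vs" and ys': "ys = U @ g # X @ h # V"
      using ex_ordered_adjacent_pair[OF ys(1) len minimum_imp_loc_opt[OF ys(2) inc_ys]] pos
      by blast
    have "vdet [x] [h] \<le> 0" if "x \<in> set X" "vdet [g] [x] > 0" for x
    proof (rule ccontr)
      assume "\<not> vdet [x] [h] \<le> 0"
      moreover have "x \<in> set xs" using that ys' mset_eq_setD[OF ys(1)] by auto
      ultimately show False
        using loc_opt_not_in_cone[of us g h vs x] opt inc pos[OF xs] that(2)
        by (simp add: xs)
    qed
    with minimum_adjacent_positive[of U g X h V] ys inc_ys pos[OF xs]
    have "\<exists>U' V'. mset (U' @ g # h # V') = mset ys \<and> minimum (U' @ g # h # V')"
      unfolding ys' by blast
    then show ?thesis using xs ys(1) by metis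
  qed
qed

section \<open>Induction on the number of functions by merging a pair\<close>

lemma concat_map_singleton: "concat (map (\<lambda>x. [x]) xs) = xs"
  by (induction xs) auto

lemma map_composite_singleton: "map composite (map (\<lambda>x. [x]) xs) = xs"
  by (induction xs) (auto simp: composite_def)

theorem loc_opt_imp_minimum:
  assumes "loc_opt xs" "increasing xs"
  shows "minimum xs"
  using assms
proof (induction "length xs" arbitrary: xs rule: less_induct)
  case less
  show ?case
  proof (cases "length xs \<ge> 2")
    case False
    then have "xs = [] \<or> (\<exists>x. xs = [x])" by (cases xs; cases "tl xs") auto
    then show ?thesis by (auto simp: minimum_def)
  next
    case True
    obtain us g h vs U V where xs: "xs = us @ g # h # vs"
      and eq: "mset (U @ g # h # V) = mset xs" and min: "minimum (U @ g # h # V)"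
      using ex_common_adjacent_pair[OF less.prems True] by blast
    \<comment> \<open>Concatenating this grouping restores the long list; taking the composite of
      each group gives the list with \<open>g\<close> and \<open>h\<close> merged.\<close>
    define merge where "merge us vs =
      map (\<lambda>x. [x]) us @ [[g, h]] @ map (\<lambda>x. [x]) vs" for us vs
    have concat_merge: "concat (merge us vs) = us @ g # h # vs" for us vs
      by (simp add: merge_def concat_map_singleton)
    have map_merge: "map composite (merge us vs) = us @ composite [g, h] # vs" for us vs
      unfolding merge_def map_append map_composite_singleton by simp
    have "loc_opt (us @ composite [g, h] # vs)"
      using loc_opt_map_composite[of "merge us vs"] less.prems(1)
      by (simp only: concat_merge map_merge xs)
    moreover have "increasing (us @ composite [g, h] # vs)"
      using less.prems(2) by (simp add: xs composite_def)
    ultimately have "minimum (us @ composite [g, h] # vs)"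
      using less.hyps by (simp add: xs)
    moreover have "mset (U @ composite [g, h] # V) = mset (us @ composite [g, h] # vs)"
      using eq xs by simp
    ultimately have
      "intercept (us @ composite [g, h] # vs) \<le> intercept (U @ composite [g, h] # V)"
      unfolding minimum_def by blast
    \<comment> \<open>Merging preserves intercepts, so the comparison passes to the long lists,
      where the right-hand side is already known to be least.\<close>
    then have "intercept xs \<le> intercept (U @ g # h # V)"
      by (simp only: map_merge[symmetric] intercept_map_composite concat_merge xs)
    then show ?thesis using min eq unfolding minimum_def by force
  qed
qed

section \<open>Translation between permutations and lists\<close>

definition perm_list :: "(nat \<Rightarrow> real) \<Rightarrow> (nat \<Rightarrow> real) \<Rightarrow> nat \<Rightarrow> (nat \<Rightarrow> nat) \<Rightarrow> affine list" where
  "perm_list a b n \<sigma> = map (\<lambda>i. (a i, b i)) (map \<sigma> [1..<Suc n])"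

lemma fsig_eq:
  "fsig a b n \<sigma> x = slope (perm_list a b n \<sigma>) * x + intercept (perm_list a b n \<sigma>)"
  unfolding fsig_def
  by (induction n) (simp_all add: perm_list_def lin_def algebra_simps)

text \<open>Distinct indices may carry equal pairs, so a cut of the list of pairs is lifted to the
  list of indices.\<close>

lemma map_eq_append4E:
  assumes "map f xs = us @ X @ Y @ vs"
  obtains us' X' Y' vs' where "xs = us' @ X' @ Y' @ vs'"
    "us = map f us'" "X = map f X'" "Y = map f Y'" "vs = map f vs'"
proof -
  obtain us' p where p: "xs = us' @ p" "us = map f us'" "map f p = X @ Y @ vs"
    using assms by (metis map_eq_append_conv)
  obtain X' q where q: "p = X' @ q" "X = map f X'" "map f q = Y @ vs"
    using p(3) by (metis map_eq_append_conv)
  obtain Y' vs' where r: "q = Y' @ vs'" "Y = map f Y'" "vs = map f vs'"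
    using q(3) by (metis map_eq_append_conv)
  show thesis
    by (rule that[of us' X' Y' vs']) (simp_all only: p(1,2) q(1,2) r append_assoc)
qed

text \<open>Block bounds count from 1 and list positions from 0, hence
  \<open>Suc (length us)\<close> here and \<open>Suc i\<close> in the proof.\<close>

lemma map_block_swap:
  assumes "map \<sigma> [1..<Suc n] = us @ X @ Y @ vs"
    and l: "l = Suc (length us)" and m: "m = length us + length X"
    and r: "r = length us + length X + length Y"
  shows "map (block_swap \<sigma> l m r) [1..<Suc n] = us @ Y @ X @ vs"
proof (rule nth_equalityI)
  have len: "n = length us + length X + length Y + length vs"
    using arg_cong[OF assms(1), of length] by (simp del: upt_Suc)
  then show "length (map (block_swap \<sigma> l m r) [1..<Suc n]) = length (us @ Y @ X @ vs)"
    by (simp del: upt_Suc)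
  have nth: "\<sigma> (Suc i) = (us @ X @ Y @ vs) ! i" if "i < n" for i
    using arg_cong[OF assms(1), of "\<lambda>xs. xs ! i"] that by (simp del: upt_Suc)
  fix i assume "i < length (map (block_swap \<sigma> l m r) [1..<Suc n])"
  then have i: "i < n" by (simp del: upt_Suc)
  \<comment> \<open>These are the ranges of \<open>us\<close>, \<open>Y\<close>, \<open>X\<close>
    and \<open>vs\<close> after the swap. Entries of \<open>Y\<close> come from
    \<open>length X\<close> places further right, those of \<open>X\<close> from
    \<open>length Y\<close> places further left.\<close>
  consider "i < length us" | "length us \<le> i" "i < length us + length Y"
    | "length us + length Y \<le> i" "i < r" | "r \<le> i"
    by linarith
  then have "block_swap \<sigma> l m r (Suc i) = (us @ Y @ X @ vs) ! i"
  proof cases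
    case 1
    then show ?thesis using nth[OF i] by (simp add: block_swap_def l nth_append)
  next
    case 2
    then have "block_swap \<sigma> l m r (Suc i) = \<sigma> (Suc (i + length X))"
      by (simp add: block_swap_def l m r algebra_simps)
    also have "\<dots> = (us @ X @ Y @ vs) ! (i + length X)"
      using 2 len by (intro nth) simp
    finally show ?thesis using 2 by (auto simp: nth_append)
  next
    case 3
    then have "block_swap \<sigma> l m r (Suc i) = \<sigma> (Suc (i - length Y))"
      by (simp add: block_swap_def l m r Suc_diff_le)
    also have "\<dots> = (us @ X @ Y @ vs) ! (i - length Y)"
      using i by (intro nth) simp
    also have "\<dots> = (us @ Y @ X @ vs) ! i"
    proof -
      obtain j where j: "i = length us + length Y + j"
        using 3 le_Suc_ex by blast
      then have "i - length Y = length us + j" by simp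
      then show ?thesis using 3 r j by (simp add: nth_append)
    qed
    finally show ?thesis .
  next
    case 4
    then obtain j where j: "i = r + j" using le_Suc_ex by blast
    have "block_swap \<sigma> l m r (Suc i) = \<sigma> (Suc i)"
      using 4 by (simp add: block_swap_def)
    also have "\<dots> = (us @ X @ Y @ vs) ! i" by (rule nth[OF i])
    also have "\<dots> = vs ! j" by (simp add: j r nth_append)
    also have "\<dots> = (us @ Y @ X @ vs) ! i" by (simp add: j r nth_append)
    finally show ?thesis .
  qed
  then show "map (block_swap \<sigma> l m r) [1..<Suc n] ! i = (us @ Y @ X @ vs) ! i"
    using i by (simp del: upt_Suc)
qed

lemma mset_map_permutes:
  assumes "\<sigma> permutes {1..n}"
  shows "mset (map \<sigma> [1..<Suc n]) = mset [1..<Suc n]"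
proof -
  have "mset (map \<sigma> [1..<Suc n]) = image_mset \<sigma> (mset_set {1..n})"
    by (simp only: mset_map mset_upt atLeastLessThanSuc_atLeastAtMost)
  also have "\<dots> = mset_set (\<sigma> ` {1..n})"
    by (rule image_mset_mset_set) (rule permutes_inj_on[OF assms])
  also have "\<dots> = mset [1..<Suc n]"
    by (simp only: permutes_image[OF assms] mset_upt atLeastLessThanSuc_atLeastAtMost)
  finally show ?thesis .
qed

lemma mset_perm_list:
  assumes "\<sigma> permutes {1..n}"
  shows "mset (perm_list a b n \<sigma>) = image_mset (\<lambda>i. (a i, b i)) (mset [1..<Suc n])"
  unfolding perm_list_def mset_map[of "\<lambda>i. (a i, b i)"] mset_map_permutes[OF assms] ..

text \<open>On \<open>{1..n}\<close> the values are those of \<sigma> rearranged, and elsewhere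
  nothing changes. Thus neighbours are among the competitors of a minimum.\<close>

lemma block_swap_permutes:
  assumes perm: "\<sigma> permutes {1..n}" and lmr: "1 \<le> l" "l \<le> m" "m < r" "r \<le> n"
  shows "block_swap \<sigma> l m r permutes {1..n}"
proof -
  let ?L = "map \<sigma> [1..<Suc n]"
  define us X Y vs where "us = take (l - 1) ?L" and "X = take (Suc m - l) (drop (l - 1) ?L)"
    and "Y = take (r - m) (drop m ?L)" and "vs = drop r ?L"
  have "drop m ?L = Y @ vs"
    using lmr append_take_drop_id[of "r - m" "drop m ?L"]
    by (simp add: Y_def vs_def del: upt_Suc)
  moreover have "drop (l - 1) ?L = X @ drop m ?L"
    using lmr append_take_drop_id[of "Suc m - l" "drop (l - 1) ?L"]
    by (simp add: X_def del: upt_Suc)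
  ultimately have split: "?L = us @ X @ Y @ vs"
    using append_take_drop_id[of "l - 1" ?L] by (simp add: us_def del: upt_Suc)
  have "map (block_swap \<sigma> l m r) [1..<Suc n] = us @ Y @ X @ vs"
    using lmr by (intro map_block_swap[OF split]) (auto simp: us_def X_def Y_def simp del: upt_Suc)
  then have "mset (map (block_swap \<sigma> l m r) [1..<Suc n]) = mset ?L"
    unfolding split by simp
  also note mset_map_permutes[OF perm]
  finally have eq: "mset (map (block_swap \<sigma> l m r) [1..<Suc n]) = mset [1..<Suc n]" .
  have "set [1..<Suc n] = {1..n}" by auto
  moreover have "distinct (map (block_swap \<sigma> l m r) [1..<Suc n])"
    using mset_eq_imp_distinct_iff[OF eq] by simp
  ultimately have "inj_on (block_swap \<sigma> l m r) {1..n}"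
    unfolding distinct_map by simp
  moreover have "block_swap \<sigma> l m r ` {1..n} = {1..n}"
    using mset_eq_setD[OF eq] \<open>set [1..<Suc n] = {1..n}\<close> by (simp del: upt_Suc)
  ultimately have "bij_betw (block_swap \<sigma> l m r) {1..n} {1..n}"
    by (simp add: bij_betw_def)
  moreover have "block_swap \<sigma> l m r i = i" if "i \<notin> {1..n}" for i
    using that lmr permutes_not_in[OF perm that] by (auto simp: block_swap_def)
  ultimately show ?thesis by (rule bij_imp_permutes)
qed

theorem mainTheorem12:
  fixes a b :: "nat \<Rightarrow> real" and n :: nat and \<sigma> :: "nat \<Rightarrow> nat"
  assumes mono: "\<And>i. i \<in> {1..n} \<Longrightarrow> a i > 0"
    and perm: "\<sigma> permutes {1..n}"
  shows "is_minimum a b n \<sigma> \<longleftrightarrow> locally_optimal a b n \<sigma>"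
proof
  assume "is_minimum a b n \<sigma>"
  then show "locally_optimal a b n \<sigma>"
    using block_swap_permutes[OF perm]
    by (auto simp: is_minimum_def locally_optimal_def nbhd_def)
next
  assume opt: "locally_optimal a b n \<sigma>"
  let ?f = "\<lambda>i. (a i, b i)"
  have inc: "increasing (perm_list a b n \<sigma>)"
    using mono permutes_in_image[OF perm] unfolding increasing_def perm_list_def
    by (auto simp del: upt_Suc)
  have "loc_opt (perm_list a b n \<sigma>)"
    unfolding loc_opt_def
  proof (intro allI impI)
    fix us X Y vs assume eq: "perm_list a b n \<sigma> = us @ X @ Y @ vs"
    show "vdet X Y \<ge> 0"
    \<comment> \<open>Neighbours arise only from nonempty blocks, so empty ones are treated
      apart.\<close>
    proof (cases "X = [] \<or> Y = []")
      case True
      then show ?thesis by auto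
    next
      case False
      obtain us' X' Y' vs' where split: "map \<sigma> [1..<Suc n] = us' @ X' @ Y' @ vs'"
        and maps: "us = map ?f us'" "X = map ?f X'" "Y = map ?f Y'" "vs = map ?f vs'"
        using eq unfolding perm_list_def by (rule map_eq_append4E)
      let ?l = "Suc (length us')" and ?m = "length us' + length X'"
      let ?r = "length us' + length X' + length Y'"
      have "n = ?r + length vs'"
        using arg_cong[OF split, of length] by (simp del: upt_Suc)
      moreover have "X' \<noteq> []" "Y' \<noteq> []" using False maps by auto
      ultimately have "1 \<le> ?l \<and> ?l \<le> ?m \<and> ?m < ?r \<and> ?r \<le> n"
        by (auto simp: Suc_le_eq)
      then have "block_swap \<sigma> ?l ?m ?r \<in> nbhd n \<sigma>"
        unfolding nbhd_def by blast
      \<comment> \<open>Evaluation at 0 isolates the intercept.\<close>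
      then have "fsig a b n \<sigma> 0 \<le> fsig a b n (block_swap \<sigma> ?l ?m ?r) 0"
        using opt unfolding locally_optimal_def by blast
      moreover have "perm_list a b n (block_swap \<sigma> ?l ?m ?r) = us @ Y @ X @ vs"
        unfolding perm_list_def map_block_swap[OF split refl refl refl] by (simp add: maps)
      ultimately have "intercept (us @ X @ Y @ vs) \<le> intercept (us @ Y @ X @ vs)"
        by (simp only: fsig_eq eq mult_zero_right add_0_left)
      then have "slope vs * vdet X Y \<ge> 0"
        unfolding intercept_swap[of us Y X vs] by simp
      moreover have "slope vs > 0" using inc by (simp add: eq slope_pos)
      ultimately show ?thesis by (simp add: zero_le_mult_iff)
    qed
  qed
  then have min: "minimum (perm_list a b n \<sigma>)"
    using inc by (rule loc_opt_imp_minimum)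
  show "is_minimum a b n \<sigma>"
    unfolding is_minimum_def
  proof (intro allI impI)
    fix \<rho> x assume "\<rho> permutes {1..n}"
    then have eq: "mset (perm_list a b n \<rho>) = mset (perm_list a b n \<sigma>)"
      using perm by (simp only: mset_perm_list)
    have "slope (perm_list a b n \<rho>) = slope (perm_list a b n \<sigma>)"
      using eq unfolding slope_def by (metis mset_map prod_mset_prod_list)
    moreover have "intercept (perm_list a b n \<sigma>) \<le> intercept (perm_list a b n \<rho>)"
      using min eq by (simp add: minimum_def)
    ultimately show "fsig a b n \<sigma> x \<le> fsig a b n \<rho> x"
      by (simp add: fsig_eq)
  qed
qed

end
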